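(* Suppose that $\vec{x} = \langle x_\alpha \mid \alpha < \omega_1\rangle$ is an ascending sequence of sets, $H$ is a nonzero abelian group, and $\mathrm{w}\diamondsuit(\omega_1)$ holds. Then there is a nontrivial coherent $1$-family $\Phi = \langle \varphi_\alpha : x_\alpha \to H \mid \alpha < \omega_1\rangle$. Moreover, if $\vec{e} = \langle e_w \mid w \in \mathrm{Fn}^+(\omega_1)\rangle$ and $C$ witness that $\vec{x}$ is ascending, then $\Phi$ can be chosen to be supported on $\vec{e}$.
   Context: Notation: $u =^* v$ for functions means they agree at all but finitely many points of their common domain; $\varphi =^* 0$ means $\varphi$ is nonzero at only finitely many points; $u\subseteq^* v$ means $u\setminus v$ is finite. For a nonempty set $Y$, $\mathrm{Fn}^+(Y)$ is the set of finite partial functions $w$ from $Y$ to $2$ with $w^{-1}\{1\}\neq\emptyset$. Let $\delta$ be a limit ordinal of uncountable cofinality and $\vec{x} = \langle x_\alpha \mid \alpha<\delta\rangle$ a sequence of sets. For $w \in \mathrm{Fn}^+(\delta)$, $\vec{x}$ respects $w$ if $d_w := \bigcap_{\beta\in w^{-1}\{1\}} x_\beta \setminus \bigcup_{\alpha \in w^{-1}\{0\}} x_\alpha$ is infinite. $\vec{x}$ is ascending if there are $\langle e_w \mid w\in\mathrm{Fn}^+(\delta)\rangle$ and a club $C\subseteq\delta$ (said to witness ascendingness) such that: (a) if $\vec{x}$ respects $w$ then $e_w$ is a countably infinite subset of $d_w$, otherwise $e_w=\emptyset$; (b) for all $\beta\in C$ and finite $a\subseteq\beta$, $x_\beta \not\subseteq^*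 \bigcup_{\alpha\in a}x_\alpha$; (c) for every finite $a\subseteq C$ and every $w\in\mathrm{Fn}^+(\min(a))$ respected by $\vec{x}$, the set $e_w\cap\bigcap_{\beta\in a}x_\beta$ is infinite. A $1$-family $\langle\varphi_\alpha:x_\alpha\to H\mid \alpha<\delta\rangle$ is coherent if $\varphi_\alpha =^* \varphi_\beta$ for all $\alpha,\beta<\delta$, and trivial if there is $\psi:\bigcup_\alpha x_\alpha\to H$ with $\psi\restriction x_\alpha =^*\varphi_\alpha$ for all $\alpha$. It is supported on $\vec{e}$ if for all $\alpha$, $\mathrm{supp}(\varphi_\alpha) = \{z : \varphi_\alpha(z)\neq 0\} \subseteq \bigcup\{e_w \mid w\in\mathrm{Fn}^+(\alpha)\}$. $\mathrm{w}\diamondsuit(\omega_1)$: for every $F:{}^{<\omega_1}2\to 2$ there is $g:\omega_1\to 2$ such that for every $b:\omega_1\to2$ the set $\{\alpha<\omega_1 \mid g(\alpha) = F(b\restriction\alpha)\}$ is stationary. *)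

theory Defs
  imports Main "HOL-Library.Countable_Set"
begin

section \<open>The first uncountable ordinal\<close>

typedef omega1 = "Field (cardSuc natLeq)"
proof -
  have "infinite (Field (cardSuc natLeq))"
    unfolding cardSuc_finite[OF natLeq_Card_order] by (simp add: Field_natLeq)
  then show ?thesis using infinite_imp_nonempty by blast
qed

lemma Well_order_cardSuc_natLeq: "Well_order (cardSuc natLeq)"
  using cardSuc_Card_order[OF natLeq_Card_order] card_order_on_well_order_on by blast

instantiation omega1 :: wellorder
begin

definition less_eq_omega1 :: "omega1 \<Rightarrow> omega1 \<Rightarrow> bool" where
  "a \<le> b \<longleftrightarrow> (Rep_omega1 a, Rep_omega1 b) \<in> cardSuc natLeq"

definition less_omega1 :: "omega1 \<Rightarrow> omega1 \<Rightarrow> bool" where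
  "a < b \<longleftrightarrow> a \<le> b \<and> \<not> b \<le> (a :: omega1)"

instance
proof
  let ?r = "cardSuc natLeq"
  have lin: "Linear_order ?r" and wf: "wf (?r - Id)"
    using Well_order_cardSuc_natLeq by (simp_all add: well_order_on_def)
  have re: "Refl ?r" and tr: "trans ?r" and an: "antisym ?r" and tot: "Total ?r"
    using lin by (simp_all add: order_on_defs)
  fix a b c :: omega1
  show "a < b \<longleftrightarrow> a \<le> b \<and> \<not> b \<le> a" by (rule less_omega1_def)
  show refl: "a \<le> a" for a :: omega1
    unfolding less_eq_omega1_def by (rule refl_onD[OF re Rep_omega1])
  show "a \<le> b \<Longrightarrow> b \<le> c \<Longrightarrow> a \<le> c"
    unfolding less_eq_omega1_def by (rule transD[OF tr])
  show anti: "a \<le> b \<Longrightarrow> b \<le> a \<Longrightarrow> a = b" for a b :: omega1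
    unfolding less_eq_omega1_def by (metis antisymD[OF an] Rep_omega1_inject)
  show "a \<le> b \<or> b \<le> a"
  proof (cases "a = b")
    case True
    then show ?thesis using refl by simp
  next
    case False
    then have "Rep_omega1 a \<noteq> Rep_omega1 b" by (simp add: Rep_omega1_inject)
    then show ?thesis
      unfolding less_eq_omega1_def
      using tot Rep_omega1[of a] Rep_omega1[of b] by (simp add: total_on_def)
  qed
  fix P :: "omega1 \<Rightarrow> bool" and a
  assume step: "\<And>x. (\<And>y. y < x \<Longrightarrow> P y) \<Longrightarrow> P x"
  have "wf (inv_image (cardSuc natLeq - Id) Rep_omega1)"
    using wf by (rule wf_inv_image)
  then show "P a"
  proof (induction a rule: wf_induct_rule)
    case (less x)
    show ?case
    proof (rule step)
      fix y assume "y < x"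
      then have "(y, x) \<in> inv_image (cardSuc natLeq - Id) Rep_omega1"
        by (auto simp: less_omega1_def less_eq_omega1_def in_inv_image)
      then show "P y" by (rule less)
    qed
  qed
qed

end

lemma uncountable_omega1: "uncountable (UNIV :: omega1 set)"
  including cardinal_syntax
proof
  assume "countable (UNIV :: omega1 set)"
  then have "countable (range Rep_omega1)" by (rule countable_image)
  then have "countable (Field (cardSuc natLeq))"
    using type_definition.Rep_range[OF type_definition_omega1] by simp
  then obtain f :: "nat set \<Rightarrow> nat" where "inj_on f (Field (cardSuc natLeq))"
    unfolding countable_def by blast
  then have "|Field (cardSuc natLeq)| \<le>o |UNIV :: nat set|"
    using card_of_ordLeq[of "Field (cardSuc natLeq)" "UNIV :: nat set"] by blast
  moreover have "|Field (cardSuc natLeq)| =o cardSuc natLeq"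
    by (rule card_of_Field_ordIso[OF cardSuc_Card_order[OF natLeq_Card_order]])
  ultimately have "cardSuc natLeq \<le>o natLeq"
    using card_of_nat ordIso_ordLeq_trans ordIso_symmetric ordLeq_ordIso_trans by metis
  moreover have "natLeq <o cardSuc natLeq" by (rule cardSuc_greater[OF natLeq_Card_order])
  ultimately show False using not_ordLess_ordLeq by blast
qed

lemma countable_lessThan_omega1: "countable {..<a :: omega1}"
  including cardinal_syntax
proof -
  have CO: "Card_order (cardSuc natLeq)" by (rule cardSuc_Card_order[OF natLeq_Card_order])
  have "|underS (cardSuc natLeq) (Rep_omega1 a)| <o cardSuc natLeq"
    by (rule card_of_underS[OF CO Rep_omega1])
  then have "|underS (cardSuc natLeq) (Rep_omega1 a)| \<le>o natLeq"
    using cardSuc_ordLeq_ordLess[OF natLeq_Card_order card_of_Card_order] by blast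
  then have "|underS (cardSuc natLeq) (Rep_omega1 a)| \<le>o |UNIV :: nat set|"
    using card_of_nat ordIso_symmetric ordLeq_ordIso_trans by blast
  then obtain f :: "nat set \<Rightarrow> nat" where "inj_on f (underS (cardSuc natLeq) (Rep_omega1 a))"
    using card_of_ordLeq[of "underS (cardSuc natLeq) (Rep_omega1 a)" "UNIV :: nat set"] by blast
  then have "countable (underS (cardSuc natLeq) (Rep_omega1 a))"
    unfolding countable_def by blast
  moreover have "Rep_omega1 ` {..<a} \<subseteq> underS (cardSuc natLeq) (Rep_omega1 a)"
    by (auto simp: underS_def less_eq_omega1_def order_less_le Rep_omega1_inject)
  ultimately have "countable (Rep_omega1 ` {..<a})" by (rule countable_subset[rotated])
  then show ?thesis by (rule countable_image_inj_on) (simp add: inj_on_def Rep_omega1_inject)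
qed

section \<open>Club and stationary sets, weak diamond\<close>

text \<open>A limit ordinal \<open>\<delta>\<close> is represented by a well-ordered type \<open>'i\<close>; the ordinal
  \<open>\<alpha> < \<delta>\<close>, viewed as a set, is \<open>{..<\<alpha>}\<close>.\<close>

text \<open>Closedness is required only at nonzero points, since the least element satisfies the
  condition on cofinality vacuously; a nonzero point satisfying it is a limit point of \<open>C\<close>.\<close>

definition club :: "'i::wellorder set \<Rightarrow> bool" where
  "club C \<longleftrightarrow>
     (\<forall>\<alpha>. \<exists>\<gamma>\<in>C. \<alpha> < \<gamma>) \<and>
     (\<forall>\<alpha>. (\<exists>\<beta>. \<beta> < \<alpha>) \<and> (\<forall>\<beta><\<alpha>. \<exists>\<gamma>\<in>C. \<beta> < \<gamma> \<and> \<gamma> < \<alpha>) \<longrightarrow> \<alpha> \<in> C)"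

definition stationary :: "'i::wellorder set \<Rightarrow> bool" where
  "stationary S \<longleftrightarrow> (\<forall>C. club C \<longrightarrow> S \<inter> C \<noteq> {})"

text \<open>The set \<open>2\<close> is \<open>bool\<close>. A function \<open>\<alpha> \<rightarrow> 2\<close> is a partial map with domain \<open>{..<\<alpha>}\<close>, so
  that restrictions to different ordinals are different; the values of \<open>F\<close> at maps whose domain
  is not of this form play no role.\<close>

definition weak_diamond_omega1 :: bool where
  "weak_diamond_omega1 \<longleftrightarrow>
     (\<forall>F :: (omega1 \<rightharpoonup> bool) \<Rightarrow> bool. \<exists>g :: omega1 \<Rightarrow> bool. \<forall>b :: omega1 \<Rightarrow> bool.
        stationary {\<alpha>. g \<alpha> = F ((\<lambda>\<beta>. Some (b \<beta>)) |` {..<\<alpha>})})"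

section \<open>Ascending sequences\<close>

definition almost_subset :: "'a set \<Rightarrow> 'a set \<Rightarrow> bool" (infix \<open>\<subseteq>*\<close> 50) where
  "u \<subseteq>* v \<longleftrightarrow> finite (u - v)"

definition Fn_plus :: "'i set \<Rightarrow> ('i \<rightharpoonup> bool) set" where
  "Fn_plus Y = {w. finite (dom w) \<and> dom w \<subseteq> Y \<and> w -` {Some True} \<noteq> {}}"

definition dset :: "('i \<Rightarrow> 'a set) \<Rightarrow> ('i \<rightharpoonup> bool) \<Rightarrow> 'a set" where
  "dset x w = (\<Inter>\<beta> \<in> w -` {Some True}. x \<beta>) - (\<Union>\<alpha> \<in> w -` {Some False}. x \<alpha>)"

definition respects_map :: "('i \<Rightarrow> 'a set) \<Rightarrow> ('i \<rightharpoonup> bool) \<Rightarrow> bool" where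
  "respects_map x w \<longleftrightarrow> infinite (dset x w)"

text \<open>Only the values of \<open>e\<close> on \<open>Fn_plus UNIV\<close> matter.\<close>

definition witness_ascending ::
  "('i::wellorder \<Rightarrow> 'a set) \<Rightarrow> (('i \<rightharpoonup> bool) \<Rightarrow> 'a set) \<Rightarrow> 'i set \<Rightarrow> bool" where
  "witness_ascending x e C \<longleftrightarrow>
     club C \<and>
     (\<forall>w \<in> Fn_plus UNIV.
        if respects_map x w then countable (e w) \<and> infinite (e w) \<and> e w \<subseteq> dset x w
        else e w = {}) \<and>
     (\<forall>\<beta>\<in>C. \<forall>a. finite a \<and> a \<subseteq> {..<\<beta>} \<longrightarrow> \<not> (x \<beta> \<subseteq>* (\<Union>\<alpha>\<in>a. x \<alpha>))) \<and>
     (\<forall>a. finite a \<and> a \<noteq> {} \<and> a \<subseteq> C \<longrightarrow>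
        (\<forall>w \<in> Fn_plus {..<Min a}. respects_map x w \<longrightarrow> infinite (e w \<inter> (\<Inter>\<beta>\<in>a. x \<beta>))))"

definition ascending :: "('i::wellorder \<Rightarrow> 'a set) \<Rightarrow> bool" where
  "ascending x \<longleftrightarrow> (\<exists>e C. witness_ascending x e C)"

section \<open>One-families\<close>

text \<open>A family \<open>\<langle>\<phi>\<^sub>\<alpha> : x\<^sub>\<alpha> \<rightarrow> H\<rangle>\<close> is given by total functions of which only the restrictions
  to the sets \<open>x \<alpha>\<close> are used; likewise only the restriction of the trivialising \<open>\<psi>\<close> to
  \<open>\<Union>\<alpha>. x \<alpha>\<close> is used.\<close>

definition eq_star_on :: "'a set \<Rightarrow> ('a \<Rightarrow> 'h) \<Rightarrow> ('a \<Rightarrow> 'h) \<Rightarrow> bool" where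
  "eq_star_on D u v \<longleftrightarrow> finite {z \<in> D. u z \<noteq> v z}"

definition coherent_family :: "('i \<Rightarrow> 'a set) \<Rightarrow> ('i \<Rightarrow> 'a \<Rightarrow> 'h) \<Rightarrow> bool" where
  "coherent_family x \<phi> \<longleftrightarrow> (\<forall>\<alpha> \<beta>. eq_star_on (x \<alpha> \<inter> x \<beta>) (\<phi> \<alpha>) (\<phi> \<beta>))"

definition trivial_family :: "('i \<Rightarrow> 'a set) \<Rightarrow> ('i \<Rightarrow> 'a \<Rightarrow> 'h) \<Rightarrow> bool" where
  "trivial_family x \<phi> \<longleftrightarrow> (\<exists>\<psi>. \<forall>\<alpha>. eq_star_on (x \<alpha>) \<psi> (\<phi> \<alpha>))"

definition supp_on :: "'a set \<Rightarrow> ('a \<Rightarrow> 'h::zero) \<Rightarrow> 'a set" where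
  "supp_on D u = {z \<in> D. u z \<noteq> 0}"

definition supported_on ::
  "('i::wellorder \<Rightarrow> 'a set) \<Rightarrow> (('i \<rightharpoonup> bool) \<Rightarrow> 'a set) \<Rightarrow> ('i \<Rightarrow> 'a \<Rightarrow> 'h::zero) \<Rightarrow> bool" where
  "supported_on x e \<phi> \<longleftrightarrow> (\<forall>\<alpha>. supp_on (x \<alpha>) (\<phi> \<alpha>) \<subseteq> (\<Union>w \<in> Fn_plus {..<\<alpha>}. e w))"

end

theory Submission
  imports Defs
begin

text \<open>For limit points \<open>\<alpha>\<close> of \<open>C\<close>, ascendingness yields an infinite countable
  \<open>D\<^sub>\<alpha> \<subseteq> x\<^sub>\<alpha>\<close> that is supported on \<open>\<^bold>e\<close> below \<open>\<alpha>\<close> and almost disjoint from all \<open>x\<^sub>\<gamma>\<close> with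
  \<open>\<gamma> < \<alpha>\<close>. A coherent family below the countable ordinal \<open>\<alpha>\<close> is trivial, so it extends to \<open>\<alpha>\<close>,
  and the values of the extension on \<open>D\<^sub>\<alpha>\<close> are free: take them constantly \<open>h \<noteq> 0\<close> or constantly \<open>0\<close>,
  as prescribed by a weak diamond sequence \<open>g\<close>. It is chosen for the colouring which, from
  a trivialisation \<open>\<psi>\<close> restricted to the countable set that supports the family at \<open>\<alpha>\<close>, asks
  whether \<open>\<psi>\<close> is almost zero on \<open>D\<^sub>\<alpha>\<close>. If \<open>\<psi>\<close> trivialised the family, then
  \<open>g\<close> would guess the answer correctly at some \<open>\<alpha>\<close>, and there \<open>\<psi>\<close> disagrees with the family on an
  infinite subset of \<open>D\<^sub>\<alpha>\<close>.\<close>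

section \<open>Countable sets and closure points in the first uncountable ordinal\<close>

lemma countable_bounded_omega1:
  fixes S :: "omega1 set"
  assumes "countable S"
  shows "\<exists>\<gamma>. \<forall>\<beta>\<in>S. \<beta> < \<gamma>"
proof -
  have "countable (\<Union>\<beta>\<in>S. insert \<beta> {..<\<beta>})"
    using assms countable_lessThan_omega1 by blast
  then obtain \<gamma> where "\<gamma> \<notin> (\<Union>\<beta>\<in>S. insert \<beta> {..<\<beta>})"
    using uncountable_omega1 by (metis UNIV_eq_I)
  then show ?thesis
    by (intro exI[of _ \<gamma>]) (auto simp: not_less order_less_le)
qed

text \<open>As \<open>h\<close> need not be monotone, it is first majorised by some \<open>k\<close>
  with \<open>k \<beta>\<close> above all \<open>h \<beta>'\<close> for
  \<open>\<beta>' \<le> \<beta>\<close>; initial segments are countable, so such a \<open>k\<close>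
  exists. The least strict upper bound of the iterates of \<open>k\<close> at
  \<open>\<alpha>\<close> is closed under \<open>h\<close>, since anything smaller lies below some
  iterate.\<close>

lemma club_closed_under:
  fixes h :: "omega1 \<Rightarrow> omega1"
  shows "club {\<alpha>. (\<exists>\<beta>. \<beta> < \<alpha>) \<and> (\<forall>\<beta><\<alpha>. h \<beta> < \<alpha>)}" (is "club ?C")
  unfolding club_def
proof (intro conjI allI impI)
  fix \<alpha> :: omega1
  have "\<exists>\<gamma>. \<beta> < \<gamma> \<and> (\<forall>\<beta>'\<le>\<beta>. h \<beta>' < \<gamma>)" for \<beta> :: omega1
  proof -
    have "countable (insert \<beta> (h ` insert \<beta> {..<\<beta>}))"
      using countable_lessThan_omega1 by blast
    then obtain \<gamma> where "\<forall>\<xi>\<in>insert \<beta> (h ` insert \<beta> {..<\<beta>}). \<xi> < \<gamma>"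
      using countable_bounded_omega1 by blast
    then show ?thesis by (auto simp: order_le_less)
  qed
  then obtain k where k: "\<And>\<beta>. \<beta> < k \<beta>" "\<And>\<beta> \<beta>'. \<beta>' \<le> \<beta> \<Longrightarrow> h \<beta>' < k \<beta>"
    by metis
  define s where "s n = (k ^^ n) \<alpha>" for n
  have s_Suc: "s (Suc n) = k (s n)" for n
    by (simp add: s_def)
  obtain \<gamma> where \<gamma>: "\<forall>\<beta>\<in>range s. \<beta> < \<gamma>"
    using countable_bounded_omega1[of "range s"] by auto
  define \<delta> where "\<delta> = (LEAST \<delta>. \<forall>n. s n < \<delta>)"
  have s_less: "s n < \<delta>" for n
    unfolding \<delta>_def using LeastI[of "\<lambda>\<delta>. \<forall>n. s n < \<delta>" \<gamma>] \<gamma> by blast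
  have "h \<beta> < \<delta>" if \<beta>: "\<beta> < \<delta>" for \<beta>
  proof -
    obtain n where "\<beta> \<le> s n"
      using not_less_Least[of \<beta> "\<lambda>\<delta>. \<forall>n. s n < \<delta>"] \<beta> by (auto simp: \<delta>_def[symmetric] not_less)
    then have "h \<beta> < s (Suc n)"
      unfolding s_Suc by (rule k(2))
    then show ?thesis using s_less[of "Suc n"] by simp
  qed
  moreover have "\<alpha> < \<delta>"
    using s_less[of 0] by (simp add: s_def)
  ultimately show "\<exists>\<gamma>\<in>?C. \<alpha> < \<gamma>" by blast
next
  fix \<alpha> :: omega1
  assume "(\<exists>\<beta>. \<beta> < \<alpha>) \<and> (\<forall>\<beta><\<alpha>. \<exists>\<gamma>\<in>?C. \<beta> < \<gamma> \<and> \<gamma> < \<alpha>)"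
  then show "\<alpha> \<in> ?C" by (blast intro: less_trans)
qed

section \<open>Diagonalisation over countable index sets\<close>

lemma eq_star_on_commute: "eq_star_on D u v \<longleftrightarrow> eq_star_on D v u"
  by (simp add: eq_star_on_def eq_commute)

lemma eq_star_on_refl: "eq_star_on D u u"
  by (simp add: eq_star_on_def)

text \<open>A recursion only records agreement of each function with the earlier ones; symmetry
  supplies the rest.\<close>

lemma coherent_pairI:
  fixes i j :: "'i::linorder"
  assumes "\<And>i j. i \<in> I \<Longrightarrow> j < i \<Longrightarrow> eq_star_on (x i \<inter> x j) (\<phi> i) (\<phi> j)"
    and "i \<in> I" "j \<in> I"
  shows "eq_star_on (x i \<inter> x j) (\<phi> i) (\<phi> j)"
  using assms by (metis Int_commute eq_star_on_commute eq_star_on_refl linorder_less_linear)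

text \<open>Enumerate \<open>I\<close> by \<open>f\<close> and let \<open>\<psi>\<close> copy, at
  each point, the function of the first index whose set contains it. On \<open>x i\<close> only the
  finitely many indices up to \<open>i\<close> compete, and each contributes finitely many errors.
  The second conclusion keeps control of the support of \<open>\<psi>\<close>.\<close>

lemma countable_coherent_trivial:
  fixes \<phi> :: "'i \<Rightarrow> 'a \<Rightarrow> 'h::zero"
  assumes "countable I"
    and coh: "\<And>i j. i \<in> I \<Longrightarrow> j \<in> I \<Longrightarrow> eq_star_on (x i \<inter> x j) (\<phi> i) (\<phi> j)"
  obtains \<psi> where "\<And>i. i \<in> I \<Longrightarrow> eq_star_on (x i) \<psi> (\<phi> i)"
    and "\<And>z. \<psi> z \<noteq> 0 \<Longrightarrow> \<exists>i\<in>I. z \<in> x i \<and> \<psi> z = \<phi> i z"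
proof -
  obtain f :: "'i \<Rightarrow> nat" where inj: "inj_on f I"
    using \<open>countable I\<close> by (rule countableE)
  define first where "first z = arg_min f (\<lambda>i. i \<in> I \<and> z \<in> x i)" for z
  have first: "first z \<in> I" "z \<in> x (first z)" "f (first z) \<le> f i" if "i \<in> I" "z \<in> x i" for i z
    using arg_min_nat_lemma[of "\<lambda>i. i \<in> I \<and> z \<in> x i" i f] that by (auto simp: first_def)
  define \<psi> where "\<psi> z = (if \<exists>i\<in>I. z \<in> x i then \<phi> (first z) z else 0)" for z
  have "eq_star_on (x i) \<psi> (\<phi> i)" if "i \<in> I" for i
  proof -
    let ?J = "{j \<in> I. f j \<le> f i}"
    have "finite ?J"
      by (rule inj_on_finite[of f _ "{..f i}"]) (use inj in \<open>auto intro: inj_on_subset\<close>)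
    then have "finite (\<Union>j\<in>?J. {z \<in> x j \<inter> x i. \<phi> j z \<noteq> \<phi> i z})"
      using coh that by (auto simp: eq_star_on_def)
    moreover have "{z \<in> x i. \<psi> z \<noteq> \<phi> i z} \<subseteq> (\<Union>j\<in>?J. {z \<in> x j \<inter> x i. \<phi> j z \<noteq> \<phi> i z})"
    proof
      fix z assume "z \<in> {z \<in> x i. \<psi> z \<noteq> \<phi> i z}"
      then have "z \<in> x i" "\<phi> (first z) z \<noteq> \<phi> i z"
        using that by (auto simp: \<psi>_def split: if_splits)
      then show "z \<in> (\<Union>j\<in>?J. {z \<in> x j \<inter> x i. \<phi> j z \<noteq> \<phi> i z})"
        using first[OF that] by (intro UN_I[of "first z"]) auto
    qed
    ultimately show ?thesis
      unfolding eq_star_on_def by (rule finite_subset[rotated])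
  qed
  moreover have "\<exists>i\<in>I. z \<in> x i \<and> \<psi> z = \<phi> i z" if "\<psi> z \<noteq> 0" for z
    using that first by (metis \<psi>_def)
  ultimately show ?thesis by (rule that)
qed

text \<open>Choose \<open>z n\<close> new and outside every \<open>x i\<close> with
  \<open>f i < n\<close>. Then \<open>z n \<in> x i\<close> forces \<open>n \<le> f i\<close>, so
  \<open>x i\<close> meets the range only finitely often.\<close>

lemma infinite_almost_disjoint_subset:
  fixes x :: "'i \<Rightarrow> 'a set"
  assumes "countable I"
    and inf: "\<And>a. finite a \<Longrightarrow> a \<subseteq> I \<Longrightarrow> infinite (K - (\<Union>i\<in>a. x i))"
  obtains D where "D \<subseteq> K" "infinite D" "\<And>i. i \<in> I \<Longrightarrow> finite (D \<inter> x i)"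
proof -
  obtain f :: "'i \<Rightarrow> nat" where inj: "inj_on f I"
    using \<open>countable I\<close> by (rule countableE)
  define P where "P z n r \<longleftrightarrow> r \<in> K - (\<Union>i\<in>{i\<in>I. f i < n}. x i) - z ` {..<n}"
    for z :: "nat \<Rightarrow> 'a" and n r
  have "\<exists>z. \<forall>n. P z n (z n)"
  proof (rule dependent_wellorder_choice)
    show "P z n r = P z' n r" if "\<And>m. m < n \<Longrightarrow> z m = z' m" for z z' n r
      using that by (auto simp: P_def image_iff)
    show "\<exists>r. P z n r" for z n
    proof -
      have "finite {i\<in>I. f i < n}"
        by (rule inj_on_finite[of f _ "{..<n}"]) (use inj in \<open>auto intro: inj_on_subset\<close>)
      then have "infinite (K - (\<Union>i\<in>{i\<in>I. f i < n}. x i) - z ` {..<n})"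
        by (rule Diff_infinite_finite[OF _ inf, rotated]) auto
      then have "K - (\<Union>i\<in>{i\<in>I. f i < n}. x i) - z ` {..<n} \<noteq> {}"
        using infinite_imp_nonempty by blast
      then show ?thesis unfolding P_def by blast
    qed
  qed
  then obtain z where z: "\<And>n. P z n (z n)" by blast
  have "inj z"
  proof (rule linorder_injI)
    fix m n :: nat assume "m < n"
    then show "z m \<noteq> z n" using z[of n] unfolding P_def by (metis DiffD2 imageI lessThan_iff)
  qed
  then have "infinite (range z)" by (rule range_inj_infinite)
  moreover have "range z \<subseteq> K" using z by (auto simp: P_def)
  moreover have "finite (range z \<inter> x i)" if "i \<in> I" for i
  proof (rule finite_subset)
    have "n \<le> f i" if "z n \<in> x i" for n
      using z[of n] that \<open>i \<in> I\<close> unfolding P_def by (auto intro: leI)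
    then show "range z \<inter> x i \<subseteq> z ` {..f i}" by blast
  qed simp
  ultimately show ?thesis by (intro that)
qed

section \<open>Finite partial functions and ascending sequences\<close>

lemma countable_Fn_plus:
  assumes "countable Y"
  shows "countable (Fn_plus Y)"
proof (rule countable_image_inj_on)
  have "Map.graph ` Fn_plus Y \<subseteq> {G. finite G \<and> G \<subseteq> Y \<times> UNIV}"
    by (auto simp: Fn_plus_def) (auto simp: graph_def)
  then show "countable (Map.graph ` Fn_plus Y)"
    by (rule countable_subset)
      (use assms countable_Collect_finite_subset[of "Y \<times> (UNIV :: bool set)"] in simp)
  show "inj_on Map.graph (Fn_plus Y)"
    by (auto simp: inj_on_def graph_def fun_eq_iff set_eq_iff)
      (metis not_None_eq)
qed

lemma Fn_plus_mono: "Y \<subseteq> Z \<Longrightarrow> Fn_plus Y \<subseteq> Fn_plus Z"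
  by (auto simp: Fn_plus_def)

lemma Fn_plus_limit:
  fixes \<alpha> :: "'i::wellorder"
  assumes "w \<in> Fn_plus {..<\<alpha>}" and lim: "\<And>\<beta>. \<beta> < \<alpha> \<Longrightarrow> \<exists>\<gamma><\<alpha>. \<beta> < \<gamma>"
  obtains \<beta> where "\<beta> < \<alpha>" "w \<in> Fn_plus {..<\<beta>}"
proof -
  have w: "finite (dom w)" "dom w \<noteq> {}" "dom w \<subseteq> {..<\<alpha>}"
    using assms(1) by (auto simp: Fn_plus_def)
  then have "Max (dom w) < \<alpha>" by (meson Max_in lessThan_iff subsetD)
  then obtain \<gamma> where "\<gamma> < \<alpha>" "Max (dom w) < \<gamma>" using lim by blast
  moreover from this have "w \<in> Fn_plus {..<\<gamma>}"
    using assms(1) w by (auto simp: Fn_plus_def)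
  ultimately show ?thesis using that by blast
qed

text \<open>By diagonalisation it suffices to remove finitely many \<open>x \<gamma>\<close>,
  \<open>\<gamma> \<in> a\<close>, at a time. Pick \<open>\<beta> \<in> C\<close> between
  \<open>a\<close> and \<open>\<alpha>\<close> and let \<open>w\<close> be 1 at
  \<open>\<beta>\<close> and 0 on \<open>a\<close>. Clause (b) makes \<open>w\<close> respected,
  clause (c) for \<open>{\<alpha>}\<close> makes \<open>e w \<inter> x \<alpha>\<close> infinite,
  and \<open>e w \<subseteq> dset x w\<close> avoids the removed sets.\<close>

lemma ascending_almost_disjoint_subset:
  fixes x :: "omega1 \<Rightarrow> 'a set"
  assumes wit: "witness_ascending x e C" and "\<alpha> \<in> C"
    and lim: "\<And>\<beta>. \<beta> < \<alpha> \<Longrightarrow> \<exists>\<gamma>\<in>C. \<beta> < \<gamma> \<and> \<gamma> < \<alpha>" and "\<beta>\<^sub>0 < \<alpha>"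
  obtains D where "D \<subseteq> x \<alpha> \<inter> (\<Union>w\<in>Fn_plus {..<\<alpha>}. e w)" "infinite D"
    "\<And>\<gamma>. \<gamma> < \<alpha> \<Longrightarrow> finite (D \<inter> x \<gamma>)"
proof -
  let ?K = "x \<alpha> \<inter> (\<Union>w\<in>Fn_plus {..<\<alpha>}. e w)"
  have inf: "infinite (?K - (\<Union>\<gamma>\<in>a. x \<gamma>))" if a: "finite a" "a \<subseteq> {..<\<alpha>}" for a
  proof -
    \<comment> \<open>Inserting \<open>\<beta>\<^sub>0\<close> keeps the maximum meaningful when
      \<open>a\<close> is empty.\<close>
    have "Max (insert \<beta>\<^sub>0 a) < \<alpha>"
      using a \<open>\<beta>\<^sub>0 < \<alpha>\<close> by auto
    then obtain \<beta> where \<beta>: "\<beta> \<in> C" "\<beta> < \<alpha>" "Max (insert \<beta>\<^sub>0 a) < \<beta>"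
      using lim by blast
    then have a\<beta>: "a \<subseteq> {..<\<beta>}"
      using a by auto
    define w where "w \<xi> = (if \<xi> = \<beta> then Some True else if \<xi> \<in> a then Some False else None)" for \<xi>
    have dom: "dom w = insert \<beta> a" and T: "w -` {Some True} = {\<beta>}" and F: "w -` {Some False} = a"
      using a\<beta> by (auto simp: w_def split: if_splits)
    then have w: "w \<in> Fn_plus {..<\<alpha>}"
      using a \<beta> by (auto simp: Fn_plus_def)
    then have w': "w \<in> Fn_plus UNIV"
      using Fn_plus_mono[OF subset_UNIV] by blast
    have dset: "dset x w = x \<beta> - (\<Union>\<gamma>\<in>a. x \<gamma>)"
      by (simp add: dset_def T F)
    have "respects_map x w"
      using wit \<beta>(1) a(1) a\<beta> by (auto simp: witness_ascending_def respects_map_def dset almost_subset_def)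
    then have "e w \<subseteq> dset x w"
      using wit w' by (auto simp: witness_ascending_def)
    have "infinite (e w \<inter> (\<Inter>\<beta>\<in>{\<alpha>}. x \<beta>))"
      using wit \<open>\<alpha> \<in> C\<close> w \<open>respects_map x w\<close> unfolding witness_ascending_def
      by (metis Min_singleton empty_subsetI finite.simps insert_not_empty insert_subset)
    moreover have "e w \<inter> (\<Inter>\<beta>\<in>{\<alpha>}. x \<beta>) \<subseteq> ?K - (\<Union>\<gamma>\<in>a. x \<gamma>)"
      using \<open>e w \<subseteq> dset x w\<close> w dset by auto
    ultimately show ?thesis
      using finite_subset by blast
  qed
  show ?thesis
    by (rule infinite_almost_disjoint_subset[of "{..<\<alpha>}" ?K x])
      (use countable_lessThan_omega1 inf that in auto)
qed

section \<open>The family guided by weak diamond\<close>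

lemma ascending_nontrivial_coherent_family:
  fixes x :: "omega1 \<Rightarrow> 'a set" and h :: "'h::zero"
  assumes wit: "witness_ascending x e C" and "h \<noteq> 0" and wd: "weak_diamond_omega1"
  shows "\<exists>\<phi> :: omega1 \<Rightarrow> 'a \<Rightarrow> 'h.
    coherent_family x \<phi> \<and> \<not> trivial_family x \<phi> \<and> supported_on x e \<phi>"
  including cardinal_syntax
proof -
  have "club C" using wit by (simp add: witness_ascending_def)
  define E where "E \<alpha> = (\<Union>w\<in>Fn_plus {..<\<alpha>}. e w)" for \<alpha>
  have E_mono: "E \<beta> \<subseteq> E \<alpha>" if "\<beta> \<le> \<alpha>" for \<alpha> \<beta>
    using Fn_plus_mono[of "{..<\<beta>}" "{..<\<alpha>}"] that unfolding E_def by fastforce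
  have E_countable: "countable (E \<alpha>)" for \<alpha>
  proof -
    have "countable (e w)" if "w \<in> Fn_plus {..<\<alpha>}" for w
    proof -
      have "w \<in> Fn_plus UNIV" using that Fn_plus_mono[OF subset_UNIV] by blast
      then show ?thesis
        using wit by (cases "respects_map x w") (auto simp: witness_ascending_def)
    qed
    then show ?thesis
      unfolding E_def using countable_Fn_plus[OF countable_lessThan_omega1] by blast
  qed

  \<comment> \<open>A union of \<open>\<omega>_1\<close> many countable sets injects into
    \<open>omega1\<close>. The injection \<open>f\<close> allows a trivialisation to be coded by a
    branch \<open>omega1 \<Rightarrow> bool\<close>.\<close>
  have "infinite (UNIV :: omega1 set)"
    using uncountable_omega1 uncountable_infinite by blast
  then have "|\<Union>\<alpha>. E \<alpha>| \<le>o |UNIV :: omega1 set|"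
  proof (rule card_of_UNION_ordLeq_infinite)
    show "\<forall>\<alpha>\<in>UNIV. |E \<alpha>| \<le>o |UNIV :: omega1 set|"
    proof
      fix \<alpha>
      have "|E \<alpha>| \<le>o |UNIV :: nat set|"
        using E_countable[of \<alpha>] card_of_ordLeq unfolding countable_def by blast
      also have "|UNIV :: nat set| \<le>o |UNIV :: omega1 set|"
        using \<open>infinite (UNIV :: omega1 set)\<close> by (simp add: infinite_iff_card_of_nat)
      finally show "|E \<alpha>| \<le>o |UNIV :: omega1 set|" .
    qed
  qed (rule card_of_mono1[OF subset_UNIV])
  then obtain f :: "'a \<Rightarrow> omega1" where inj: "inj_on f (\<Union>\<alpha>. E \<alpha>)"
    by (metis card_of_ordLeq)

  have "\<exists>\<gamma>\<in>C. \<beta> < \<gamma> \<and> f ` E \<beta> \<subseteq> {..<\<gamma>}" for \<beta>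
  proof -
    have "countable (insert \<beta> (f ` E \<beta>))"
      using E_countable by blast
    then obtain \<gamma> where "\<forall>\<xi>\<in>insert \<beta> (f ` E \<beta>). \<xi> < \<gamma>"
      using countable_bounded_omega1 by blast
    moreover obtain \<gamma>' where "\<gamma>' \<in> C" "\<gamma> < \<gamma>'"
      using \<open>club C\<close> unfolding club_def by blast
    ultimately show ?thesis
      by (intro bexI[of _ \<gamma>']) (auto intro: less_trans)
  qed
  then obtain k where k: "\<And>\<beta>. k \<beta> \<in> C" "\<And>\<beta>. \<beta> < k \<beta>" "\<And>\<beta>. f ` E \<beta> \<subseteq> {..<k \<beta>}"
    by metis
  \<comment> \<open>Nonzero closure points of \<open>k\<close> are limits of points of
    \<open>C\<close>, and the codes of the elements of \<open>E \<alpha>\<close> all lie below such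
    an \<open>\<alpha>\<close>. Hence a branch cut off at \<open>\<alpha>\<close> still describes
    \<open>\<psi>\<close> on all of \<open>E \<alpha>\<close>.\<close>
  define L where "L = {\<alpha>. (\<exists>\<beta>. \<beta> < \<alpha>) \<and> (\<forall>\<beta><\<alpha>. k \<beta> < \<alpha>)}"
  have "club L" unfolding L_def by (rule club_closed_under)
  have f_less: "f z < \<alpha>" if \<alpha>: "\<alpha> \<in> L" and z: "z \<in> E \<alpha>" for \<alpha> z
  proof -
    obtain w where w: "w \<in> Fn_plus {..<\<alpha>}" "z \<in> e w"
      using z by (auto simp: E_def)
    \<comment> \<open>As \<open>\<alpha>\<close> is a limit, the finite domain of \<open>w\<close>
      is bounded below it.\<close>
    obtain \<beta> where "\<beta> < \<alpha>" "w \<in> Fn_plus {..<\<beta>}"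
      by (rule Fn_plus_limit[OF w(1)]) (use \<alpha> k(2) in \<open>auto simp: L_def\<close>)
    then have "f z < k \<beta>"
      using w(2) k(3)[of \<beta>] by (auto simp: E_def)
    also have "k \<beta> < \<alpha>"
      using \<alpha> \<open>\<beta> < \<alpha>\<close> by (simp add: L_def)
    finally show ?thesis .
  qed

  \<comment> \<open>Off \<open>L\<close> the empty set serves, so the recursion below can treat all
    \<open>\<alpha>\<close> alike.\<close>
  have "\<exists>D. D \<subseteq> x \<alpha> \<inter> E \<alpha> \<and> (\<alpha> \<in> L \<longrightarrow> infinite D) \<and> (\<forall>\<gamma><\<alpha>. finite (D \<inter> x \<gamma>))" for \<alpha>
  proof (cases "\<alpha> \<in> L")
    case True
    then obtain \<beta>\<^sub>0 where "\<beta>\<^sub>0 < \<alpha>" by (auto simp: L_def)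
    have lim: "\<exists>\<gamma>\<in>C. \<beta> < \<gamma> \<and> \<gamma> < \<alpha>" if "\<beta> < \<alpha>" for \<beta>
      using that k(1,2)[of \<beta>] True unfolding L_def by blast
    then have "\<alpha> \<in> C"
      using \<open>club C\<close> \<open>\<beta>\<^sub>0 < \<alpha>\<close> unfolding club_def by blast
    show ?thesis
      by (rule ascending_almost_disjoint_subset[OF wit \<open>\<alpha> \<in> C\<close> lim \<open>\<beta>\<^sub>0 < \<alpha>\<close>])
        (auto simp: E_def)
  qed auto
  then obtain D where D: "\<And>\<alpha>. D \<alpha> \<subseteq> x \<alpha> \<inter> E \<alpha>" "\<And>\<alpha>. \<alpha> \<in> L \<Longrightarrow> infinite (D \<alpha>)"
    "\<And>\<alpha> \<gamma>. \<gamma> < \<alpha> \<Longrightarrow> finite (D \<alpha> \<inter> x \<gamma>)"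
    by metis

  text \<open>The least ordinal outside the domain recovers \<open>\<alpha>\<close> from a map with domain \<open>{..<\<alpha>}\<close>.\<close>
  define F :: "(omega1 \<rightharpoonup> bool) \<Rightarrow> bool" where
    "F s = finite {z \<in> D (LEAST \<beta>. s \<beta> = None). s (f z) = Some True}" for s
  obtain g :: "omega1 \<Rightarrow> bool" where g:
    "\<And>b. stationary {\<alpha>. g \<alpha> = F ((\<lambda>\<beta>. Some (b \<beta>)) |` {..<\<alpha>})}"
    using wd unfolding weak_diamond_omega1_def by blast

  \<comment> \<open>The support bound belongs to the recursion: the extension at
    \<open>\<alpha>\<close> takes its nonzero values off \<open>D \<alpha>\<close> from earlier
    functions.\<close>
  define P where "P \<phi> \<alpha> u \<longleftrightarrow> supp_on (x \<alpha>) u \<subseteq> E \<alpha> \<and>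
      (\<forall>\<gamma><\<alpha>. eq_star_on (x \<alpha> \<inter> x \<gamma>) u (\<phi> \<gamma>)) \<and> (\<forall>z\<in>D \<alpha>. u z = (if g \<alpha> then h else 0))"
    for \<phi> :: "omega1 \<Rightarrow> 'a \<Rightarrow> 'h" and \<alpha> u
  have "\<exists>\<phi>. \<forall>\<alpha>. P \<phi> \<alpha> (\<phi> \<alpha>)"
  proof (rule dependent_wellorder_choice)
    show "P \<phi> \<alpha> u = P \<phi>' \<alpha> u" if "\<And>\<beta>. \<beta> < \<alpha> \<Longrightarrow> \<phi> \<beta> = \<phi>' \<beta>" for \<phi> \<phi>' \<alpha> u
      using that by (auto simp: P_def)
    fix \<alpha> and \<phi> :: "omega1 \<Rightarrow> 'a \<Rightarrow> 'h"
    assume IH: "\<And>\<beta>. \<beta> < \<alpha> \<Longrightarrow> P \<phi> \<beta> (\<phi> \<beta>)"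
    have coh: "eq_star_on (x i \<inter> x j) (\<phi> i) (\<phi> j)" if "i \<in> {..<\<alpha>}" "j \<in> {..<\<alpha>}" for i j
      using _ that by (rule coherent_pairI) (use IH in \<open>auto simp: P_def\<close>)
    obtain \<psi> where \<psi>: "\<And>\<gamma>. \<gamma> \<in> {..<\<alpha>} \<Longrightarrow> eq_star_on (x \<gamma>) \<psi> (\<phi> \<gamma>)"
      and \<psi>_supp: "\<And>z. \<psi> z \<noteq> 0 \<Longrightarrow> \<exists>\<gamma>\<in>{..<\<alpha>}. z \<in> x \<gamma> \<and> \<psi> z = \<phi> \<gamma> z"
      by (rule countable_coherent_trivial[OF countable_lessThan_omega1 coh]) blast+
    \<comment> \<open>Overwriting \<open>\<psi>\<close> on \<open>D \<alpha>\<close> changes it at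
      only finitely many points of each \<open>x \<gamma>\<close> with
      \<open>\<gamma> < \<alpha>\<close>, so coherence survives.\<close>
    define u where "u z = (if z \<in> D \<alpha> then if g \<alpha> then h else 0 else \<psi> z)" for z
    have "z \<in> E \<alpha>" if z: "u z \<noteq> 0" for z
    proof (cases "z \<in> D \<alpha>")
      case True
      then show ?thesis using D(1) by blast
    next
      case False
      then obtain \<gamma> where "\<gamma> < \<alpha>" "z \<in> supp_on (x \<gamma>) (\<phi> \<gamma>)"
        using z \<psi>_supp[of z] False by (auto simp: u_def supp_on_def)
      then show ?thesis
        using IH[of \<gamma>] E_mono[of \<gamma> \<alpha>] unfolding P_def by (meson less_imp_le subsetD)
    qed
    moreover have "eq_star_on (x \<alpha> \<inter> x \<gamma>) u (\<phi> \<gamma>)" if "\<gamma> < \<alpha>" for \<gamma>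
    proof -
      have "finite ((D \<alpha> \<inter> x \<gamma>) \<union> {z \<in> x \<gamma>. \<psi> z \<noteq> \<phi> \<gamma> z})"
        using D(3) \<psi> that by (auto simp: eq_star_on_def)
      then show ?thesis
        unfolding eq_star_on_def by (rule rev_finite_subset) (auto simp: u_def)
    qed
    ultimately have "P \<phi> \<alpha> u"
      by (auto simp: P_def u_def supp_on_def)
    then show "\<exists>u. P \<phi> \<alpha> u" by blast
  qed
  then obtain \<phi> where \<phi>: "\<And>\<alpha>. P \<phi> \<alpha> (\<phi> \<alpha>)" by blast

  have "eq_star_on (x \<alpha> \<inter> x \<beta>) (\<phi> \<alpha>) (\<phi> \<beta>)" for \<alpha> \<beta>
    by (rule coherent_pairI[of UNIV]) (use \<phi> in \<open>auto simp: P_def\<close>)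
  then have "coherent_family x \<phi>"
    by (simp add: coherent_family_def)
  moreover have "supported_on x e \<phi>"
    using \<phi> by (simp add: supported_on_def P_def E_def)
  moreover have "\<not> trivial_family x \<phi>"
  proof
    assume "trivial_family x \<phi>"
    then obtain \<psi> where \<psi>: "\<And>\<alpha>. eq_star_on (x \<alpha>) \<psi> (\<phi> \<alpha>)"
      by (auto simp: trivial_family_def)
    \<comment> \<open>The branch records, through the coding \<open>f\<close>, where
      \<open>\<psi>\<close> is nonzero.\<close>
    define b where "b \<beta> \<longleftrightarrow> \<psi> (inv_into (\<Union>\<alpha>. E \<alpha>) f \<beta>) \<noteq> 0" for \<beta>
    obtain \<alpha> where "\<alpha> \<in> L" and g\<alpha>: "g \<alpha> = F ((\<lambda>\<beta>. Some (b \<beta>)) |` {..<\<alpha>})"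
      using g[of b] \<open>club L\<close> unfolding stationary_def by blast
    let ?s = "(\<lambda>\<beta>. Some (b \<beta>)) |` {..<\<alpha>}"
    have "(LEAST \<beta>. ?s \<beta> = None) = \<alpha>"
      by (rule Least_equality) (auto simp: restrict_map_def split: if_splits)
    moreover have "?s (f z) = Some (\<psi> z \<noteq> 0)" if "z \<in> D \<alpha>" for z
    proof -
      have "z \<in> E \<alpha>" using that D(1) by blast
      then have "inv_into (\<Union>\<alpha>. E \<alpha>) f (f z) = z"
        by (intro inv_into_f_f[OF inj]) auto
      then show ?thesis
        using f_less[OF \<open>\<alpha> \<in> L\<close> \<open>z \<in> E \<alpha>\<close>] by (simp add: b_def)
    qed
    ultimately have "g \<alpha> \<longleftrightarrow> finite {z \<in> D \<alpha>. \<psi> z \<noteq> 0}"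
      unfolding g\<alpha> F_def by (simp cong: conj_cong)
    moreover have fin: "finite {z \<in> D \<alpha>. \<psi> z \<noteq> (if g \<alpha> then h else 0)}"
      using \<psi>[of \<alpha>] unfolding eq_star_on_def
      by (rule rev_finite_subset) (use D(1)[of \<alpha>] \<phi>[of \<alpha>] in \<open>auto simp: P_def\<close>)
    \<comment> \<open>If \<open>g \<alpha>\<close> failed, \<open>fin\<close> would say that
      \<open>\<psi>\<close> is almost zero on \<open>D \<alpha>\<close>, which is equivalent to
      \<open>g \<alpha>\<close>. So \<open>g \<alpha>\<close> holds, and \<open>\<psi>\<close> is
      almost 0 and almost \<open>h\<close> on the infinite set \<open>D \<alpha>\<close>.\<close>
    ultimately have "g \<alpha>" "finite {z \<in> D \<alpha>. \<psi> z \<noteq> 0}" by (auto split: if_splits)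
    then have "finite ({z \<in> D \<alpha>. \<psi> z \<noteq> 0} \<union> {z \<in> D \<alpha>. \<psi> z \<noteq> h})"
      using fin by simp
    moreover have "D \<alpha> \<subseteq> {z \<in> D \<alpha>. \<psi> z \<noteq> 0} \<union> {z \<in> D \<alpha>. \<psi> z \<noteq> h}"
      using \<open>h \<noteq> 0\<close> by auto
    ultimately show False
      using D(2)[OF \<open>\<alpha> \<in> L\<close>] finite_subset by blast
  qed
  ultimately show ?thesis by blast
qed

theorem theorem3p5:
  fixes x :: "omega1 \<Rightarrow> 'a set"
  assumes "ascending x"
    and "\<exists>h :: 'h::ab_group_add. h \<noteq> 0"
    and "weak_diamond_omega1"
  shows "(\<exists>\<phi> :: omega1 \<Rightarrow> 'a \<Rightarrow> 'h. coherent_family x \<phi> \<and> \<not> trivial_family x \<phi>) \<and>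
    (\<forall>e C. witness_ascending x e C \<longrightarrow>
       (\<exists>\<phi> :: omega1 \<Rightarrow> 'a \<Rightarrow> 'h.
          coherent_family x \<phi> \<and> \<not> trivial_family x \<phi> \<and> supported_on x e \<phi>))"
proof -
  have "\<exists>\<phi> :: omega1 \<Rightarrow> 'a \<Rightarrow> 'h.
      coherent_family x \<phi> \<and> \<not> trivial_family x \<phi> \<and> supported_on x e \<phi>"
    if "witness_ascending x e C" for e C
    using assms(2) ascending_nontrivial_coherent_family[OF that _ assms(3)] by blast
  then show ?thesis
    using assms(1) unfolding ascending_def by blast
qed

end
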